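(* Let $d$ be an integer with $1 \le d \le 3$, let $h\ge 1$ be an integer such that a Hadamard matrix of order $h$ exists, and let $n = h+d$. Put $\mu = 1 + \frac{h}{2^h}\binom{h}{h/2}$, and let $\eta = d-1$ if $1 \le d \le 2$, and $\eta = 5h^{1/2}+3$ if $d = 3$. Then \[ \mathcal{D}(n) \ge h^{h/2}(\mu^d - \eta) \quad\text{and}\quad \mathcal{R}(n) > \left(\frac{2}{\pi e}\right)^{d/2}. \]
   Context: A Hadamard matrix of order $h$ is an $h\times h$ matrix $A$ with entries in $\{\pm 1\}$ such that $A A^T = hI$ (so the orders $1$ and $2$ are included). For a positive integer $n$, $\mathcal{D}(n)$ denotes the maximum of $\det(M)$ over all $n\times n$ matrices $M$ with entries in $\{\pm 1\}$, and $\mathcal{R}(n) := \mathcal{D}(n)/n^{n/2}$. Every Hadamard order other than $1$ is even; for $h=1$ the binomial coefficient is read via the Gamma function, $\binom{h}{h/2} = \Gamma(h+1)/\Gamma(h/2+1)^2$ (so $\binom{1}{1/2} = 4/\pi$). *)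

theory Defs
  imports "HOL-Analysis.Gamma_Function" "Jordan_Normal_Form.Determinant"
begin

definition sign_matrices :: "nat \<Rightarrow> real mat set" where
  "sign_matrices n = {M \<in> carrier_mat n n. \<forall>i<n. \<forall>j<n. M $$ (i, j) \<in> {1, -1}}"

definition hadamard_matrix :: "nat \<Rightarrow> real mat \<Rightarrow> bool" where
  "hadamard_matrix h A \<longleftrightarrow> A \<in> sign_matrices h \<and> A * transpose_mat A = real h \<cdot>\<^sub>m 1\<^sub>m h"

definition max_det :: "nat \<Rightarrow> real" where
  "max_det n = Max (Determinant.det ` sign_matrices n)"

definition max_det_ratio :: "nat \<Rightarrow> real" where
  "max_det_ratio n = max_det n / real n powr (real n / 2)"

(* The coefficient "h choose h/2". For odd h (among Hadamard orders, only h = 1) the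
   lower index is not an integer and the Gamma function extension is used; for even h
   the two expressions agree, see half_binomial_eq_Gamma. *)
definition half_binomial :: "nat \<Rightarrow> real" where
  "half_binomial h =
     (if even h then real (h choose (h div 2))
      else Gamma (real h + 1) / Gamma (real h / 2 + 1) ^ 2)"

lemma half_binomial_eq_Gamma:
  "half_binomial h = Gamma (real h + 1) / Gamma (real h / 2 + 1) ^ 2"
proof (cases "even h")
  case True
  then obtain k where k: "h = 2 * k" by (elim evenE)
  have "Gamma (real m + 1) = fact m" for m
    using Gamma_fact[of m, where ?'a = real] by (simp add: add.commute)
  from this[of k] this[of "2 * k"] show ?thesis
    unfolding half_binomial_def using k
    by (simp add: binomial_fact power2_eq_square)
qed (simp add: half_binomial_def)

lemma half_binomial_1: "half_binomial 1 = 4 / pi"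
proof -
  have "(1 / 2 :: real) \<notin> \<int>\<^sub>\<le>\<^sub>0" by (auto dest: nonpos_Ints_nonpos)
  then have "Gamma (1 / 2 + 1 :: real) = sqrt pi / 2"
    using Gamma_plus1[of "1/2 :: real"] Gamma_one_half_real
    by (simp add: add.commute)
  moreover have "Gamma (1 + 1 :: real) = 1"
    using Gamma_plus1[of "1 :: real"] by simp
  ultimately have "Gamma (1 + 1) / Gamma (1 / 2 + 1) ^ 2 = 4 / pi"
    by (simp only:) (simp add: power_divide)
  then show ?thesis
    unfolding half_binomial_def by simp
qed

(* The set of determinants is finite and nonempty, so the Max in max_det is attained. *)
lemma finite_sign_matrices: "finite (sign_matrices n)"
proof -
  have "sign_matrices n \<subseteq>
    (\<lambda>f. mat n n f) ` (({..<n} \<times> {..<n}) \<rightarrow>\<^sub>E {1, -1 :: real})"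
  proof
    fix M assume M: "M \<in> sign_matrices n"
    let ?f = "restrict (\<lambda>ij. M $$ ij) ({..<n} \<times> {..<n})"
    have "M = mat n n ?f" "?f \<in> ({..<n} \<times> {..<n}) \<rightarrow>\<^sub>E {1, -1 :: real}"
      using M by (auto simp: sign_matrices_def)
    then show "M \<in> (\<lambda>f. mat n n f) ` (({..<n} \<times> {..<n}) \<rightarrow>\<^sub>E {1, -1 :: real})"
      by blast
  qed
  then show ?thesis
    by (rule finite_subset) (intro finite_imageI finite_PiE; simp)
qed

lemma sign_matrices_nonempty: "sign_matrices n \<noteq> {}"
proof -
  have "mat n n (\<lambda>_. 1) \<in> sign_matrices n" by (simp add: sign_matrices_def)
  then show ?thesis by blast
qed

end

theory Submission
  imports Defs
begin

text \<open>
  Border a Hadamard matrix \<open>A\<close> of order \<open>h\<close> by \<open>d\<close> random sign columns \<open>B\<close>, choosing the \<open>d\<close> new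
  rows \<open>C\<close> as the signs of the entries of \<open>B\<^sup>T A\<close>. By the Schur complement the determinant is
  \<open>\<plusminus>h\<^bsup>h/2\<^esup> det (F + D)\<close> with \<open>F = h\<^sup>-\<^sup>1 C A\<^sup>T B\<close> and \<open>-D\<close> the free corner block.
  Each diagonal entry of \<open>F\<close> has mean \<open>m = E\<bar>S\<^sub>h\<bar>\<close>, where \<open>S\<^sub>h\<close> is a sum of \<open>h\<close> independent
  random signs, so that \<open>\<mu> \<le> 1 + m\<close> (with equality for even \<open>h\<close>); each off-diagonal entry has
  mean \<open>0\<close> and variance \<open>1\<close>, and all entries are bounded by \<open>\<surd>h\<close>. Taking \<open>D\<close> with unit diagonal
  and skew-symmetric off-diagonal signs gives the mean of \<open>det (F + D)\<close> at least
  \<open>(1 + m)\<^sup>d\<close>, minus \<open>2\<surd>h\<close> when \<open>d = 3\<close>. This is sharper than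
  \<open>\<mu>\<^sup>d - \<eta>\<close>, and, with the Wallis bound on the central binomial coefficient, it exceeds
  \<open>(2n/\<pi>)\<^bsup>d/2\<^esup>\<close> in all cases except \<open>h = 2\<close>, \<open>d = 3\<close>; combined with
  \<open>(h/n)\<^bsup>h/2\<^esup> > e\<^bsup>-d/2\<^esup>\<close> this bounds \<open>\<R>(n)\<close>.
\<close>

subsection \<open>Random signs\<close>

text \<open>The set \<open>T\<close> records the positions of the entries +1, so uniform averages
  over \<open>Pow {..<h}\<close> are expectations over \<open>h\<close> independent random
  signs.\<close>

definition spin :: "nat set \<Rightarrow> nat \<Rightarrow> real" where
  "spin T l = (if l \<in> T then 1 else -1)"

lemma spin_sym_diff: "spin (sym_diff T N) l = spin T l * (if l \<in> N then -1 else 1)"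
  by (auto simp: spin_def)

text \<open>Symmetric difference with \<open>N\<close> is an involution of the power set that flips
  exactly the signs at positions in \<open>N\<close>. This invariance makes signs centred and
  uncorrelated, and lets fixed sign coefficients be absorbed.\<close>

lemma sum_Pow_sym_diff:
  assumes "N \<subseteq> A"
  shows "(\<Sum>T\<in>Pow A. g (sym_diff T N)) = (\<Sum>T\<in>Pow A. g T)"
  using assms
  by (intro sum.reindex_bij_witness[of _ "\<lambda>T. sym_diff T N" "\<lambda>T. sym_diff T N"]) auto

lemma sum_spin:
  assumes "l \<in> A" shows "(\<Sum>T\<in>Pow A. spin T l) = 0"
  using sum_Pow_sym_diff[of "{l}" A "\<lambda>T. spin T l"] assms
  by (simp add: spin_sym_diff sum_negf)

lemma sum_spin_mult:
  assumes "finite A" "l \<in> A" "l' \<in> A"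
  shows "(\<Sum>T\<in>Pow A. spin T l * spin T l') = (if l = l' then 2 ^ card A else 0)"
proof (cases "l = l'")
  case True
  have "spin T l * spin T l = 1" for T by (simp add: spin_def)
  with True show ?thesis using assms by (simp add: card_Pow)
next
  case False
  then show ?thesis
    using sum_Pow_sym_diff[of "{l}" A "\<lambda>T. spin T l * spin T l'"] assms
    by (simp add: spin_sym_diff sum_negf)
qed

lemma sum_abs_signed_spins:
  assumes "\<And>l. l < h \<Longrightarrow> a l \<in> {1, -1 :: real}"
  shows "(\<Sum>T\<in>Pow {..<h}. \<bar>\<Sum>l<h. a l * spin T l\<bar>) = (\<Sum>T\<in>Pow {..<h}. \<bar>\<Sum>l<h. spin T l\<bar>)"
proof -
  define N where "N = {l. l < h \<and> a l = -1}"
  have "a l * spin T l = spin (sym_diff T N) l" if "l < h" for l T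
    using assms[OF that] that by (auto simp: spin_sym_diff N_def)
  then have "(\<Sum>T\<in>Pow {..<h}. \<bar>\<Sum>l<h. a l * spin T l\<bar>)
      = (\<Sum>T\<in>Pow {..<h}. \<bar>\<Sum>l<h. spin (sym_diff T N) l\<bar>)"
    by (intro sum.cong refl arg_cong[where f = abs]) auto
  also have "\<dots> = (\<Sum>T\<in>Pow {..<h}. \<bar>\<Sum>l<h. spin T l\<bar>)"
    by (rule sum_Pow_sym_diff) (auto simp: N_def)
  finally show ?thesis .
qed

section \<open>The mean absolute value of a sum of random signs\<close>

lemma sum_spins_eq:
  assumes "T \<subseteq> {..<h}"
  shows "(\<Sum>l<h. spin T l) = 2 * real (card T) - real h"
proof -
  have "(\<Sum>l<h. spin T l) = (\<Sum>l<h. 2 * (if l \<in> T then 1 else 0) - 1)"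
    by (intro sum.cong) (auto simp: spin_def)
  also have "\<dots> = 2 * real (card ({..<h} \<inter> T)) - real h"
    by (simp add: sum_subtractf sum.If_cases flip: sum_distrib_left)
  also have "{..<h} \<inter> T = T" using assms by blast
  finally show ?thesis .
qed

lemma sum_Pow_card:
  assumes "finite A"
  shows "(\<Sum>T\<in>Pow A. g (card T)) = (\<Sum>j\<le>card A. real (card A choose j) * g j)"
proof -
  have "(\<Sum>T\<in>Pow A. g (card T)) = (\<Sum>j\<le>card A. \<Sum>T\<in>{T\<in>Pow A. card T = j}. g (card T))"
    by (rule sum.group[symmetric]) (use assms card_mono in auto)
  also have "\<dots> = (\<Sum>j\<le>card A. real (card A choose j) * g j)"
    using n_subsets[OF assms] by (intro sum.cong) (auto simp: Pow_def)
  finally show ?thesis .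
qed

text \<open>A binomial row weighted by the distance to its middle has closed partial sums; this is
  the instance of row \<open>2 * k\<close> cut off just below the middle.\<close>

lemma sum_choose_below_middle:
  "(\<Sum>j<k. real (2 * k choose j) * (real k - real j)) = real k / 2 * real (2 * k choose k)"
proof (cases k)
  case (Suc m)
  show ?thesis
    using gbinomial_partial_row_sum[of "real (2 * k)" m]
    unfolding binomial_gbinomial[symmetric] Suc lessThan_Suc_atMost
    by (simp del: binomial_Suc_Suc of_nat_Suc mult_Suc_right)
qed simp

text \<open>The reflection of \<open>j\<close> to \<open>2 * k - j\<close> folds the upper half of
  the row onto the lower half, and the middle term vanishes.\<close>

lemma sum_choose_abs_diff:
  "(\<Sum>j\<le>2 * k. real (2 * k choose j) * \<bar>2 * real j - real (2 * k)\<bar>) = 2 * real k * real (2 * k choose k)"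
proof -
  let ?g = "\<lambda>j. real (2 * k choose j) * \<bar>2 * real j - real (2 * k)\<bar>"
  have split: "{..2 * k} = {..<k} \<union> {k} \<union> {k<..2 * k}" by auto
  have "(\<Sum>j\<in>{k<..2 * k}. ?g j) = (\<Sum>j<k. ?g j)"
    by (rule sum.reindex_bij_witness[of _ "\<lambda>j. 2 * k - j" "\<lambda>j. 2 * k - j"])
       (auto simp: binomial_symmetric[symmetric] of_nat_diff)
  moreover have "(\<Sum>j<k. ?g j) = 2 * (\<Sum>j<k. real (2 * k choose j) * (real k - real j))"
    unfolding sum_distrib_left by (intro sum.cong) auto
  moreover have "(\<Sum>j\<le>2 * k. ?g j) = (\<Sum>j<k. ?g j) + ?g k + (\<Sum>j\<in>{k<..2 * k}. ?g j)"
    unfolding split by (subst sum.union_disjoint; force?)+ 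
  ultimately show ?thesis by (simp add: sum_choose_below_middle)
qed

lemma sum_rotate3:
  "(\<Sum>a\<in>A. \<Sum>b\<in>B. \<Sum>c\<in>C. g a b c) = (\<Sum>b\<in>B. \<Sum>c\<in>C. \<Sum>a\<in>A. g a b c)"
proof -
  have "(\<Sum>a\<in>A. \<Sum>b\<in>B. \<Sum>c\<in>C. g a b c) = (\<Sum>b\<in>B. \<Sum>a\<in>A. \<Sum>c\<in>C. g a b c)"
    by (rule sum.swap)
  also have "\<dots> = (\<Sum>b\<in>B. \<Sum>c\<in>C. \<Sum>a\<in>A. g a b c)"
    by (intro sum.cong refl sum.swap)
  finally show ?thesis .
qed

text \<open>The expected distance from the origin of a simple random walk after \<open>h\<close>
  steps.\<close>

definition mean_abs_sum :: "nat \<Rightarrow> real" where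
  "mean_abs_sum h = (\<Sum>T\<in>Pow {..<h}. \<bar>\<Sum>l<h. spin T l\<bar>) / 2 ^ h"

lemma mean_abs_sum_even:
  assumes "even h"
  shows "mean_abs_sum h = real h / 2 ^ h * real (h choose (h div 2))"
proof -
  obtain k where k: "h = 2 * k" using assms by (elim evenE)
  have "(\<Sum>T\<in>Pow {..<h}. \<bar>\<Sum>l<h. spin T l\<bar>) = (\<Sum>T\<in>Pow {..<h}. \<bar>2 * real (card T) - real h\<bar>)"
    by (intro sum.cong refl) (simp add: sum_spins_eq)
  also have "\<dots> = real h * real (h choose (h div 2))"
    using sum_Pow_card[of "{..<h}" "\<lambda>c. \<bar>2 * real c - real h\<bar>"] sum_choose_abs_diff[of k] k by simp
  finally show ?thesis by (simp add: mean_abs_sum_def)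
qed

lemma mean_abs_sum_1: "mean_abs_sum 1 = 1"
proof -
  have "Pow {..<1::nat} = {{}, {0}}" by auto
  then show ?thesis by (simp add: mean_abs_sum_def spin_def)
qed

subsection \<open>The kernel of a Hadamard matrix\<close>

text \<open>Zero is sent to +1, so that the value is always an admissible matrix entry.\<close>

definition pm_sign :: "real \<Rightarrow> real" where "pm_sign x = (if x \<ge> 0 then 1 else -1)"

lemma pm_sign_mult_self: "pm_sign x * x = \<bar>x\<bar>" by (simp add: pm_sign_def)
lemma pm_sign_cases: "pm_sign x = 1 \<or> pm_sign x = -1" by (simp add: pm_sign_def)

text \<open>These are the coordinates of \<open>A^T b\<close>, where \<open>b\<close> is the sign
  vector encoded by \<open>T\<close>.\<close>

definition transform :: "real mat \<Rightarrow> nat \<Rightarrow> nat set \<Rightarrow> nat \<Rightarrow> real" where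
  "transform A h T k = (\<Sum>l<h. A $$ (l, k) * spin T l)"

text \<open>If \<open>T j\<close> encodes column \<open>j\<close> of \<open>B\<close>, then \<open>kernel A h (T i) (T j)\<close> is the entry \<open>F\<^sub>i\<^sub>j\<close>.\<close>

definition kernel :: "real mat \<Rightarrow> nat \<Rightarrow> nat set \<Rightarrow> nat set \<Rightarrow> real" where
  "kernel A h S T = (\<Sum>k<h. pm_sign (transform A h S k) * transform A h T k) / real h"

lemma hadamard_matrixD:
  assumes "hadamard_matrix h A"
  shows "A \<in> carrier_mat h h" "i < h \<Longrightarrow> j < h \<Longrightarrow> A $$ (i, j) \<in> {1, -1}"
    "A * transpose_mat A = real h \<cdot>\<^sub>m 1\<^sub>m h"
  using assms by (auto simp: hadamard_matrix_def sign_matrices_def)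

text \<open>\<open>A^T / h\<close> is a right inverse of the square matrix \<open>A\<close>, hence
  also a left inverse.\<close>

lemma hadamard_transpose_mult:
  assumes "hadamard_matrix h A" "h \<ge> 1"
  shows "transpose_mat A * A = real h \<cdot>\<^sub>m 1\<^sub>m h"
proof -
  note A = hadamard_matrixD[OF assms(1)]
  have "A * (1 / real h \<cdot>\<^sub>m transpose_mat A) = 1 / real h \<cdot>\<^sub>m (A * transpose_mat A)"
    using A(1) by (simp add: mult_smult_distrib)
  also have "\<dots> = 1\<^sub>m h"
    unfolding A(3) using assms(2) by (intro eq_matI) auto
  finally have "(1 / real h \<cdot>\<^sub>m transpose_mat A) * A = 1\<^sub>m h"
    by (rule mat_mult_left_right_inverse[rotated 2]) (use A(1) in auto)
  then have inv: "1 / real h \<cdot>\<^sub>m (transpose_mat A * A) = 1\<^sub>m h"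
    using A(1) by (simp add: mult_smult_assoc_mat[of _ h h])
  have "transpose_mat A * A = real h \<cdot>\<^sub>m (1 / real h \<cdot>\<^sub>m (transpose_mat A * A))"
    using assms(2) by (intro eq_matI) auto
  then show ?thesis unfolding inv .
qed

lemma hadamard_row_orthogonal:
  assumes "hadamard_matrix h A" "i < h" "j < h"
  shows "(\<Sum>k<h. A $$ (i, k) * A $$ (j, k)) = (if i = j then real h else 0)"
proof -
  note A = hadamard_matrixD[OF assms(1)]
  have "(A * transpose_mat A) $$ (i, j) = (\<Sum>k<h. A $$ (i, k) * A $$ (j, k))"
    using A(1) assms by (auto simp: scalar_prod_def atLeast0LessThan intro!: sum.cong)
  then show ?thesis using A(3) assms by auto
qed

lemma hadamard_col_orthogonal:
  assumes "hadamard_matrix h A" "i < h" "j < h"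
  shows "(\<Sum>l<h. A $$ (l, i) * A $$ (l, j)) = (if i = j then real h else 0)"
proof -
  note A = hadamard_matrixD[OF assms(1)]
  have "(transpose_mat A * A) $$ (i, j) = (\<Sum>l<h. A $$ (l, i) * A $$ (l, j))"
    using A(1) assms by (auto simp: scalar_prod_def atLeast0LessThan intro!: sum.cong)
  then show ?thesis using hadamard_transpose_mult[OF assms(1)] assms by auto
qed

lemma even_if_signs_sum_0:
  fixes h :: nat
  assumes "\<And>k. k < h \<Longrightarrow> x k \<in> {1, -1 :: real}" "(\<Sum>k<h. x k) = 0"
  shows "even h"
proof -
  define T where "T = {k. k < h \<and> x k = 1}"
  have "(\<Sum>k<h. spin T k) = (\<Sum>k<h. x k)"
    by (intro sum.cong refl) (use assms(1) in \<open>fastforce simp: T_def spin_def\<close>)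
  moreover have "T \<subseteq> {..<h}" by (auto simp: T_def)
  ultimately have "real h = real (2 * card T)" using assms(2) sum_spins_eq[of T h] by simp
  then have "h = 2 * card T" by (simp only: of_nat_eq_iff)
  then show ?thesis by simp
qed

text \<open>If \<open>h > 1\<close>, the rows 0 and 1 are orthogonal, so their entrywise products
  are \<open>h\<close> signs with sum zero.\<close>

lemma hadamard_order:
  assumes "hadamard_matrix h A" "h \<ge> 1"
  shows "h = 1 \<or> even h"
proof (cases "h = 1")
  case False
  have "(\<Sum>k<h. A $$ (0, k) * A $$ (1, k)) = 0"
    using hadamard_row_orthogonal[OF assms(1), of 0 1] False assms(2) by simp
  moreover have "A $$ (0, k) * A $$ (1, k) \<in> {1, -1}" if "k < h" for k
    using hadamard_matrixD(2)[OF assms(1), of 0 k] hadamard_matrixD(2)[OF assms(1), of 1 k]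
      that False assms(2) by auto
  ultimately show ?thesis using even_if_signs_sum_0[of h "\<lambda>k. A $$ (0, k) * A $$ (1, k)"] by blast
qed simp

context
  fixes h A
  assumes A: "hadamard_matrix h A" and h: "h \<ge> 1"
begin

lemma sum_transform:
  assumes "k < h" shows "(\<Sum>T\<in>Pow {..<h}. transform A h T k) = 0"
proof -
  have "(\<Sum>T\<in>Pow {..<h}. transform A h T k)
      = (\<Sum>l<h. A $$ (l, k) * (\<Sum>T\<in>Pow {..<h}. spin T l))"
    unfolding transform_def sum_distrib_left by (rule sum.swap)
  then show ?thesis by (simp add: sum_spin)
qed

text \<open>Distinct signs are uncorrelated, so only the terms with \<open>l = l'\<close> survive,
  and orthogonality of columns evaluates them.\<close>

lemma sum_transform_mult:
  assumes "k < h" "k' < h"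
  shows "(\<Sum>T\<in>Pow {..<h}. transform A h T k * transform A h T k')
    = (if k = k' then real h * 2 ^ h else 0)"
proof -
  have "(\<Sum>T\<in>Pow {..<h}. transform A h T k * transform A h T k')
      = (\<Sum>T\<in>Pow {..<h}. \<Sum>l<h. \<Sum>l'<h. A $$ (l, k) * A $$ (l', k') * (spin T l * spin T l'))"
    unfolding transform_def sum_product by (intro sum.cong refl) (simp add: mult_ac)
  also have "\<dots> = (\<Sum>l<h. \<Sum>l'<h. \<Sum>T\<in>Pow {..<h}. A $$ (l, k) * A $$ (l', k') * (spin T l * spin T l'))"
    by (rule sum_rotate3)
  also have "\<dots> = (\<Sum>l<h. \<Sum>l'<h. A $$ (l, k) * A $$ (l', k') * (if l = l' then 2 ^ h else 0))"
    by (intro sum.cong refl) (simp add: sum_spin_mult flip: sum_distrib_left)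
  also have "\<dots> = (\<Sum>l<h. A $$ (l, k) * A $$ (l, k') * 2 ^ h)"
    by (intro sum.cong refl) (simp add: if_distrib sum.delta cong: if_cong)
  also have "\<dots> = (if k = k' then real h * 2 ^ h else 0)"
    using hadamard_col_orthogonal[OF A assms] by (simp flip: sum_distrib_right)
  finally show ?thesis .
qed

text \<open>Parseval: \<open>A / sqrt h\<close> is orthogonal and a sign vector has squared norm
  \<open>h\<close>.\<close>

lemma sum_transform_sq:
  "(\<Sum>k<h. (transform A h T k)\<^sup>2) = (real h)\<^sup>2"
proof -
  have "(\<Sum>k<h. (transform A h T k)\<^sup>2)
      = (\<Sum>k<h. \<Sum>l<h. \<Sum>l'<h. spin T l * spin T l' * (A $$ (l, k) * A $$ (l', k)))"
    unfolding transform_def power2_eq_square sum_product by (intro sum.cong refl) (simp add: mult_ac)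
  also have "\<dots> = (\<Sum>l<h. \<Sum>l'<h. \<Sum>k<h. spin T l * spin T l' * (A $$ (l, k) * A $$ (l', k)))"
    by (rule sum_rotate3)
  also have "\<dots> = (\<Sum>l<h. \<Sum>l'<h. spin T l * spin T l' * (if l = l' then real h else 0))"
    by (intro sum.cong refl) (simp add: hadamard_row_orthogonal[OF A] flip: sum_distrib_left)
  also have "\<dots> = (\<Sum>l<h. spin T l * spin T l * real h)"
    by (intro sum.cong refl) (simp add: if_distrib sum.delta cong: if_cong)
  also have "\<dots> = (\<Sum>l<h. real h)" by (intro sum.cong refl) (simp add: spin_def)
  finally show ?thesis by (simp add: power2_eq_square)
qed

text \<open>On the diagonal the signs match the transform, leaving absolute values. Columns of
  \<open>A\<close> consist of signs, so each of these is distributed like the absolute value of a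
  plain sum of random signs.\<close>

lemma sum_kernel_diag: "(\<Sum>T\<in>Pow {..<h}. kernel A h T T) = 2 ^ h * mean_abs_sum h"
proof -
  have "(\<Sum>T\<in>Pow {..<h}. kernel A h T T) = (\<Sum>k<h. \<Sum>T\<in>Pow {..<h}. \<bar>transform A h T k\<bar>) / real h"
    unfolding kernel_def pm_sign_mult_self sum_divide_distrib[symmetric] by (subst sum.swap) simp
  also have "\<dots> = (\<Sum>k<h. 2 ^ h * mean_abs_sum h) / real h"
    unfolding transform_def mean_abs_sum_def
    using hadamard_matrixD(2)[OF A]
    by (intro arg_cong2[where f = "(/)"] sum.cong refl, subst sum_abs_signed_spins) auto
  finally show ?thesis using h by simp
qed

lemma sum_kernel_right: "(\<Sum>T\<in>Pow {..<h}. kernel A h S T) = 0"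
proof -
  have "(\<Sum>T\<in>Pow {..<h}. kernel A h S T)
      = (\<Sum>k<h. pm_sign (transform A h S k) * (\<Sum>T\<in>Pow {..<h}. transform A h T k)) / real h"
    unfolding kernel_def sum_divide_distrib[symmetric] sum_distrib_left by (subst sum.swap) simp
  then show ?thesis by (simp add: sum_transform)
qed

text \<open>For fixed \<open>S\<close> the kernel is a combination, with coefficients of size
  \<open>1 / h\<close>, of \<open>h\<close> uncorrelated transforms of variance
  \<open>h\<close>.\<close>

lemma sum_kernel_right_sq: "(\<Sum>T\<in>Pow {..<h}. (kernel A h S T)\<^sup>2) = 2 ^ h"
proof -
  let ?c = "\<lambda>k. pm_sign (transform A h S k)"
  have "(\<Sum>T\<in>Pow {..<h}. (kernel A h S T)\<^sup>2)
      = (\<Sum>T\<in>Pow {..<h}. \<Sum>k<h. \<Sum>k'<h. ?c k * ?c k' * (transform A h T k * transform A h T k')) / (real h)\<^sup>2"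
    unfolding kernel_def power_divide sum_divide_distrib[symmetric] unfolding power2_eq_square sum_product
    by (intro arg_cong2[where f = "(/)"] sum.cong refl) (simp_all add: mult_ac)
  also have "\<dots> = (\<Sum>k<h. \<Sum>k'<h. \<Sum>T\<in>Pow {..<h}. ?c k * ?c k' * (transform A h T k * transform A h T k')) / (real h)\<^sup>2"
    by (simp only: sum_rotate3[where A = "Pow {..<h}"])
  also have "\<dots> = (\<Sum>k<h. \<Sum>k'<h. ?c k * ?c k' * (if k = k' then real h * 2 ^ h else 0)) / (real h)\<^sup>2"
    by (intro arg_cong2[where f = "(/)"] sum.cong refl) (simp add: sum_transform_mult flip: sum_distrib_left)
  also have "\<dots> = (\<Sum>k<h. ?c k * ?c k * (real h * 2 ^ h)) / (real h)\<^sup>2"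
    by (intro arg_cong2[where f = "(/)"] sum.cong refl) (simp add: if_distrib sum.delta cong: if_cong)
  also have "\<dots> = (\<Sum>k<h. real h * 2 ^ h) / (real h)\<^sup>2"
    by (intro arg_cong2[where f = "(/)"] sum.cong refl) (simp add: pm_sign_def)
  finally show ?thesis using h by (simp add: power2_eq_square)
qed

text \<open>Cauchy-Schwarz between the vector of signs and the transform, whose norm is known
  exactly.\<close>

lemma abs_kernel_le: "\<bar>kernel A h S T\<bar> \<le> sqrt (real h)"
proof -
  have "\<bar>\<Sum>k<h. pm_sign (transform A h S k) * transform A h T k\<bar>\<^sup>2
      \<le> (\<Sum>k<h. (pm_sign (transform A h S k))\<^sup>2) * (\<Sum>k<h. (transform A h T k)\<^sup>2)"
    using Cauchy_Schwarz_ineq_sum by simp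
  also have "(\<Sum>k<h. (pm_sign (transform A h S k))\<^sup>2) = (\<Sum>k<h. 1)"
    by (intro sum.cong refl) (simp add: pm_sign_def)
  finally have "(kernel A h S T)\<^sup>2 \<le> real h"
    using h by (simp add: sum_transform_sq kernel_def power_divide divide_le_eq)
  then show ?thesis using real_le_rsqrt[of "\<bar>kernel A h S T\<bar>"] by simp
qed

end

subsection \<open>Determinants of bordered Hadamard matrices\<close>

text \<open>Negating one row keeps the entries signs and reverses the sign of the
  determinant.\<close>

lemma abs_det_le_max_det:
  assumes M: "M \<in> sign_matrices n" and n: "n > 0"
  shows "\<bar>det M\<bar> \<le> max_det n"
proof -
  have le: "det X \<le> max_det n" if "X \<in> sign_matrices n" for X
    unfolding max_det_def using that finite_sign_matrices by (intro Max_ge) auto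
  have c: "M \<in> carrier_mat n n" using M by (simp add: sign_matrices_def)
  have "multrow 0 (-1) M \<in> sign_matrices n"
    using M c by (auto simp: sign_matrices_def)
  from le[OF this] have "- det M \<le> max_det n" using det_multrow[OF n c, of "-1"] by simp
  with le[OF M] show ?thesis by simp
qed

text \<open>Block elimination by a unit lower triangular factor. The matrix \<open>P\<close> stands
  for \<open>- C A^-1\<close>, so no inverse has to be named.\<close>

lemma det_schur_complement:
  fixes A :: "'a :: field mat"
  assumes A: "A \<in> carrier_mat h h" and B: "B \<in> carrier_mat h d"
    and C: "C \<in> carrier_mat d h" and N: "N \<in> carrier_mat d d"
    and P: "P \<in> carrier_mat d h" "P * A + C = 0\<^sub>m d h"
  shows "det (four_block_mat A B C N) = det A * det (P * B + N)"
proof -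
  let ?L = "four_block_mat (1\<^sub>m h) (0\<^sub>m h d) P (1\<^sub>m d)"
  have "?L * four_block_mat A B C N = four_block_mat A B (0\<^sub>m d h) (P * B + N)"
    using assms by (subst mult_four_block_mat[of _ h h _ d _ d]) auto
  moreover have "det (?L * four_block_mat A B C N) = det ?L * det (four_block_mat A B C N)"
    by (rule det_mult[of _ "h + d"]) (use assms in auto)
  moreover have "det ?L = 1"
    by (subst det_four_block_mat_upper_right_zero[of _ h _ d]) (use P in auto)
  moreover have "det (four_block_mat A B (0\<^sub>m d h) (P * B + N)) = det A * det (P * B + N)"
    by (rule det_four_block_mat_lower_left_zero) (use assms in auto)
  ultimately show ?thesis by simp
qed

lemma abs_det_hadamard:
  assumes "hadamard_matrix h A" "h \<ge> 1"
  shows "\<bar>det A\<bar> = real h powr (real h / 2)"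
proof -
  note A = hadamard_matrixD[OF assms(1)]
  have "det A * det A = det (A * transpose_mat A)"
    using A(1) by (simp add: det_mult[of A h] det_transpose)
  also have "\<dots> = real h ^ h" unfolding A(3) by simp
  also have "\<dots> = (real h powr (real h / 2))\<^sup>2"
    using assms(2) by (simp add: powr_realpow power2_eq_square flip: powr_add)
  finally have "\<bar>det A\<bar>\<^sup>2 = (real h powr (real h / 2))\<^sup>2"
    by (simp add: power2_eq_square)
  then show ?thesis by (rule power2_eq_imp_eq) auto
qed

lemma max_det_bordered_hadamard:
  assumes H: "hadamard_matrix h A" and h: "h \<ge> 1"
    and s: "\<And>i j. i < d \<Longrightarrow> j < d \<Longrightarrow> s i j \<in> {1, -1}"
  shows "real h powr (real h / 2) * det (mat d d (\<lambda>(i, j). s i j + kernel A h (T i) (T j))) \<le> max_det (h + d)"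
proof -
  note A = hadamard_matrixD[OF H]
  define B where "B = mat h d (\<lambda>(l, j). spin (T j) l)"
  define C where "C = mat d h (\<lambda>(i, k). pm_sign (transform A h (T i) k))"
  define N where "N = mat d d (\<lambda>(i, j). - s i j)"
  \<comment> \<open>This is \<open>- C A^-1\<close>, because the inverse of \<open>A\<close> is
    \<open>A^T / h\<close>.\<close>
  define P where "P = (- 1 / real h) \<cdot>\<^sub>m (C * transpose_mat A)"
  let ?X = "mat d d (\<lambda>(i, j). s i j + kernel A h (T i) (T j))"
  have car: "B \<in> carrier_mat h d" "C \<in> carrier_mat d h" "N \<in> carrier_mat d d" "P \<in> carrier_mat d h"
    using A(1) by (auto simp: B_def C_def N_def P_def)
  have "P * A = (- 1 / real h) \<cdot>\<^sub>m (C * (transpose_mat A * A))"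
    unfolding P_def using car A(1)
    by (simp add: mult_smult_assoc_mat[of _ d h] assoc_mult_mat[of C d h _ h])
  also have "\<dots> = - C"
    unfolding hadamard_transpose_mult[OF H h] using car h
    by (intro eq_matI) (auto simp: mult_smult_distrib[of C d h])
  finally have PA: "P * A + C = 0\<^sub>m d h" using car by (simp add: uminus_l_inv_mat)
  have "P * B = (- 1 / real h) \<cdot>\<^sub>m (C * (transpose_mat A * B))"
    unfolding P_def using car A(1)
    by (simp add: mult_smult_assoc_mat[of _ d h] assoc_mult_mat[of C d h _ h])
  moreover have "transpose_mat A * B = mat h d (\<lambda>(k, j). transform A h (T j) k)"
    using A(1) by (intro eq_matI)
      (auto simp: B_def transform_def scalar_prod_def atLeast0LessThan intro!: sum.cong)
  \<comment> \<open>Both summands carry a minus sign, so the Schur complement is the negative of the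
    wanted matrix; the factor \<open>(-1)^d\<close> disappears in the absolute value.\<close>
  ultimately have PB: "P * B + N = (-1) \<cdot>\<^sub>m ?X"
    by (intro eq_matI) (auto simp: C_def N_def kernel_def scalar_prod_def atLeast0LessThan)
  have s': "s (i - h) (j - h) = - 1"
    if "\<not> i < h" "i < h + d" "\<not> j < h" "j < h + d" "s (i - h) (j - h) \<noteq> 1" for i j
    using s[of "i - h" "j - h"] that by auto
  have "four_block_mat A B C N \<in> sign_matrices (h + d)"
    using A(1,2) car s' pm_sign_cases
    by (auto simp: sign_matrices_def B_def C_def N_def spin_def)
  then have "\<bar>det (four_block_mat A B C N)\<bar> \<le> max_det (h + d)"
    using h by (intro abs_det_le_max_det) auto
  then have "real h powr (real h / 2) * \<bar>det ?X\<bar> \<le> max_det (h + d)"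
    unfolding det_schur_complement[OF A(1) car(1-3) car(4) PA] PB
    by (simp add: abs_mult abs_det_hadamard[OF H h] power_abs)
  moreover have "real h powr (real h / 2) * det ?X \<le> real h powr (real h / 2) * \<bar>det ?X\<bar>"
    by (intro mult_left_mono) auto
  ultimately show ?thesis by linarith
qed

section \<open>Explicit determinants of orders one to three\<close>

lemma det_mat_1: "det (mat 1 1 f) = f (0, 0)"
  by (subst det_single) auto

lemma det_mat_2:
  fixes f :: "nat \<times> nat \<Rightarrow> 'a :: comm_ring_1"
  shows "det (mat 2 2 f) = f (0, 0) * f (1, 1) - f (0, 1) * f (1, 0)"
proof -
  have "det (mat 2 2 f) = (\<Sum>i<2. mat 2 2 f $$ (i, 0) * cofactor (mat 2 2 f) i 0)"
    by (rule laplace_expansion_column) auto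
  moreover have "mat_delete (mat 2 2 f) 0 0 = mat 1 1 (\<lambda>_. f (1, 1))"
    "mat_delete (mat 2 2 f) 1 0 = mat 1 1 (\<lambda>_. f (0, 1))"
    by (auto simp: mat_delete_def intro!: eq_matI)
  ultimately show ?thesis by (simp add: cofactor_def numeral_2_eq_2 det_mat_1[unfolded One_nat_def])
qed

lemma det_mat_3:
  fixes f :: "nat \<times> nat \<Rightarrow> 'a :: comm_ring_1"
  shows "det (mat 3 3 f) = f (0, 0) * (f (1, 1) * f (2, 2) - f (1, 2) * f (2, 1))
    - f (1, 0) * (f (0, 1) * f (2, 2) - f (0, 2) * f (2, 1))
    + f (2, 0) * (f (0, 1) * f (1, 2) - f (0, 2) * f (1, 1))"
proof -
  let ?d = "\<lambda>i (a, b). mat_delete (mat 3 3 f) i 0 $$ (a, b)"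
  have "det (mat 3 3 f) = (\<Sum>i<3. mat 3 3 f $$ (i, 0) * cofactor (mat 3 3 f) i 0)"
    by (rule laplace_expansion_column) auto
  also have "\<dots> = (\<Sum>i<3. f (i, 0) * ((-1) ^ i * det (mat 2 2 (?d i))))"
  proof (intro sum.cong refl)
    fix i :: nat assume "i \<in> {..<3}"
    moreover have "mat_delete (mat 3 3 f) i 0 = mat 2 2 (?d i)"
      by (intro eq_matI) (auto simp: mat_delete_def)
    ultimately show "mat 3 3 f $$ (i, 0) * cofactor (mat 3 3 f) i 0
      = f (i, 0) * ((-1) ^ i * det (mat 2 2 (?d i)))"
      by (simp add: cofactor_def)
  qed
  also have "{..<3::nat} = {0, 1, 2}" by auto
  finally show ?thesis
    by (simp add: det_mat_2 mat_delete_def) (simp add: algebra_simps numeral_2_eq_2)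
qed

subsection \<open>Averaging\<close>

lemma exists_ge_of_sum_ge:
  fixes X :: "'a \<Rightarrow> real"
  assumes "finite V" "V \<noteq> {}" "(\<Sum>a\<in>V. X a) \<ge> real (card V) * q"
  shows "\<exists>a\<in>V. X a \<ge> q"
proof (rule ccontr)
  assume "\<not> ?thesis"
  then have "(\<Sum>a\<in>V. X a) < (\<Sum>a\<in>V. q)"
    using assms by (intro sum_strict_mono) auto
  with assms(3) show False by simp
qed

definition avg :: "'a set \<Rightarrow> ('a \<Rightarrow> real) \<Rightarrow> real" where
  "avg V X = (\<Sum>a\<in>V. X a) / real (card V)"

lemma avg_add: "avg V (\<lambda>a. X a + Y a) = avg V X + avg V Y"
  and avg_diff: "avg V (\<lambda>a. X a - Y a) = avg V X - avg V Y"
  and avg_cmult: "avg V (\<lambda>a. c * X a) = c * avg V X"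
  and avg_multc: "avg V (\<lambda>a. X a * c) = avg V X * c"
  and avg_divide: "avg V (\<lambda>a. X a / c) = avg V X / c"
  by (simp_all add: avg_def sum.distrib sum_subtractf add_divide_distrib diff_divide_distrib
      flip: sum_distrib_left sum_distrib_right sum_divide_distrib)

lemma avg_swap: "avg V (\<lambda>a. avg W (\<lambda>b. X a b)) = avg W (\<lambda>b. avg V (\<lambda>a. X a b))"
  unfolding avg_def sum_divide_distrib[symmetric] by (subst sum.swap) simp

lemma avg_mono: "(\<And>a. a \<in> V \<Longrightarrow> X a \<le> Y a) \<Longrightarrow> avg V X \<le> avg V Y"
  unfolding avg_def by (intro divide_right_mono sum_mono) auto

text \<open>Means and second moments are taken in the second argument with the first one fixed, and
  \<open>f\<close> is not assumed symmetric. Hence a variable can be averaged out of a monomial when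
  it occurs once, as a second argument.\<close>

locale kernel_average =
  fixes V :: "'a set" and f :: "'a \<Rightarrow> 'a \<Rightarrow> real" and m r :: real
  assumes fin: "finite V" "V \<noteq> {}"
    and diag: "avg V (\<lambda>a. f a a) = m"
    and mean: "\<And>a. avg V (f a) = 0"
    and sq: "\<And>a. avg V (\<lambda>b. (f a b)\<^sup>2) = 1"
    and bounded: "\<And>a b. \<bar>f a b\<bar> \<le> r"
begin

lemma avg_const: "avg V (\<lambda>_. c) = c"
  using fin by (simp add: avg_def)

lemma ex_ge_avg: "\<exists>a\<in>V. X a \<ge> avg V X"
  using fin by (intro exists_ge_of_sum_ge) (auto simp: avg_def)

lemmas avg_rules = avg_add avg_diff avg_cmult avg_multc avg_const diag mean sq

text \<open>The product is at most half the sum of the two squares, and each square has mean 1 in a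
  suitable order of averaging.\<close>

lemma avg2_prod_le: "avg V (\<lambda>a. avg V (\<lambda>b. f a b * f b a)) \<le> 1"
proof -
  have "f a b * f b a \<le> ((f a b)\<^sup>2 + (f b a)\<^sup>2) / 2" for a b
    using sum_squares_bound[of "f a b" "f b a"] by simp
  then have "avg V (\<lambda>a. avg V (\<lambda>b. f a b * f b a)) \<le> avg V (\<lambda>a. avg V (\<lambda>b. ((f a b)\<^sup>2 + (f b a)\<^sup>2) / 2))"
    by (intro avg_mono)
  also have "\<dots> = (avg V (\<lambda>a. avg V (\<lambda>b. (f a b)\<^sup>2)) + avg V (\<lambda>b. avg V (\<lambda>a. (f b a)\<^sup>2))) / 2"
    by (simp only: avg_divide avg_add avg_swap[of V V "\<lambda>a b. (f b a)\<^sup>2"])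
  also have "\<dots> = 1" by (simp add: sq avg_const)
  finally show ?thesis .
qed

text \<open>One factor is bounded by \<open>r\<close>, the product of the other two by half the sum
  of their squares, which have mean 1.\<close>

lemma avg3_cycle_ge: "avg V (\<lambda>a. avg V (\<lambda>b. avg V (\<lambda>c. f a b * f b c * f c a))) \<ge> - r"
proof -
  have "- (r / 2) * ((f a b)\<^sup>2 + (f b c)\<^sup>2) \<le> f a b * f b c * f c a" for a b c
  proof -
    have "\<bar>f a b * f b c * f c a\<bar> = \<bar>f a b * f b c\<bar> * \<bar>f c a\<bar>" by (simp add: abs_mult)
    also have "\<dots> \<le> (((f a b)\<^sup>2 + (f b c)\<^sup>2) / 2) * r"
      using bounded[of c a] sum_squares_bound[of "\<bar>f a b\<bar>" "\<bar>f b c\<bar>"]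
      by (intro mult_mono) (auto simp: abs_mult)
    finally show ?thesis by (simp add: abs_le_iff algebra_simps)
  qed
  then have "avg V (\<lambda>a. avg V (\<lambda>b. avg V (\<lambda>c. - (r / 2) * ((f a b)\<^sup>2 + (f b c)\<^sup>2))))
      \<le> avg V (\<lambda>a. avg V (\<lambda>b. avg V (\<lambda>c. f a b * f b c * f c a)))"
    by (intro avg_mono)
  then show ?thesis unfolding avg_cmult avg_add avg_const sq by simp
qed

lemma exists_shift_ge_1: "\<exists>a. 1 + f a a \<ge> 1 + m"
  using ex_ge_avg[of "\<lambda>a. f a a"] by (auto simp: diag)

lemma avg2_transposed: "avg V (\<lambda>a. avg V (\<lambda>b. f b a)) = 0"
  by (subst avg_swap) (simp add: avg_rules)

text \<open>The opposite corner signs contribute the constant +1, which outweighs the mean of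
  \<open>f a b * f b a\<close>; the linear off-diagonal terms have mean zero.\<close>

lemma exists_shift_ge_2:
  "\<exists>a b. (1 + f a a) * (1 + f b b) - (1 + f a b) * (- 1 + f b a) \<ge> (1 + m)\<^sup>2"
proof -
  let ?X = "\<lambda>a b. (1 + f a a) * (1 + f b b) - (1 + f a b) * (- 1 + f b a)"
  have "avg V (\<lambda>a. avg V (?X a))
      = avg V (\<lambda>a. avg V (\<lambda>b. (1 + f a a) * (1 + f b b) - f a b * f b a + f a b - f b a + 1))"
    by (intro arg_cong[where f = "avg V"] ext) (simp add: algebra_simps)
  also have "\<dots> = (1 + m) * (1 + m) - avg V (\<lambda>a. avg V (\<lambda>b. f a b * f b a)) + 1"
    by (simp add: avg_rules avg2_transposed)
  finally have "(1 + m)\<^sup>2 \<le> avg V (\<lambda>a. avg V (?X a))"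
    using avg2_prod_le by (simp add: power2_eq_square)
  \<comment> \<open>The arguments are fixed one at a time, each choice being at least as good as the
    average over it.\<close>
  moreover obtain a where "avg V (\<lambda>a. avg V (?X a)) \<le> avg V (?X a)" using ex_ge_avg by blast
  moreover obtain b where "avg V (?X a) \<le> ?X a b" using ex_ge_avg by blast
  ultimately show ?thesis by (meson order_trans)
qed

text \<open>The off-diagonal signs are skew-symmetric: this makes the contribution of each product of
  transposed entries nonnegative, and the constant terms of the two 3-cycles cancel.\<close>

lemma exists_shift_ge_3:
  assumes m: "m \<ge> 0"
  shows "\<exists>a b c. (1 + f a a) * ((1 + f b b) * (1 + f c c) - (1 + f b c) * (- 1 + f c b))
    - (- 1 + f b a) * ((1 + f a b) * (1 + f c c) - (1 + f a c) * (- 1 + f c b))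
    + (- 1 + f c a) * ((1 + f a b) * (1 + f b c) - (1 + f a c) * (1 + f b b)) \<ge> (1 + m) ^ 3 - 2 * r"
proof -
  define D where "D = (\<lambda>a. 1 + f a a)"
  \<comment> \<open>This is \<open>(1 + f a b) * (- 1 + f b a)\<close>, the product of two
    transposed off-diagonal entries.\<close>
  define S where "S = (\<lambda>a b. f a b * f b a + f b a - f a b - 1)"
  define \<rho> where "\<rho> = avg V (\<lambda>a. avg V (\<lambda>b. f a b * f b a))"
  define \<kappa> where "\<kappa> = avg V (\<lambda>a. avg V (\<lambda>b. avg V (\<lambda>c. f a b * f b c * f c a)))"
  let ?X = "\<lambda>a b c. (1 + f a a) * ((1 + f b b) * (1 + f c c) - (1 + f b c) * (- 1 + f c b))
    - (- 1 + f b a) * ((1 + f a b) * (1 + f c c) - (1 + f a c) * (- 1 + f c b))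
    + (- 1 + f c a) * ((1 + f a b) * (1 + f b c) - (1 + f a c) * (1 + f b b))"
  \<comment> \<open>\<open>?Y\<close> and \<open>?Z\<close> collect the linear and quadratic
    monomials of the two 3-cycles; the cubic terms are treated separately, and the constants -1 and
    +1 cancel.\<close>
  let ?Y = "\<lambda>a b c. f c a + f a b * f c a - f a b + f b c * f c a - f b c - f a b * f b c"
  let ?Z = "\<lambda>a b c. f c b * f b a - f c b - f b a - f a c * f c b - f a c * f b a + f a c"
  let ?E = "\<lambda>X. avg V (\<lambda>a. avg V (\<lambda>b. avg V (\<lambda>c. X a b c)))"
  have D: "avg V D = 1 + m" by (simp add: D_def avg_rules)
  have S: "avg V (\<lambda>a. avg V (S a)) = \<rho> - 1"
    unfolding S_def \<rho>_def by (simp add: avg_rules avg2_transposed)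
  have rot: "?E X = avg V (\<lambda>b. avg V (\<lambda>c. avg V (\<lambda>a. X a b c)))" for X
    by (subst avg_swap) (subst avg_swap[of V V "\<lambda>a c. X a _ c"], rule refl)
  have swap: "?E X = avg V (\<lambda>a. avg V (\<lambda>c. avg V (\<lambda>b. X a b c)))" for X
    by (subst avg_swap[of V V "\<lambda>b c. X _ b c"]) (rule refl)
  \<comment> \<open>Each such monomial contains a variable that occurs only as a second argument;
    moving its average innermost makes it vanish.\<close>
  have "?E (\<lambda>a b c. f b c * f c a) = 0" "?E (\<lambda>a b c. f c b * f b a) = 0"
    by (subst rot, simp add: avg_rules)+
  moreover have "?E (\<lambda>a b c. f a c * f c b) = 0" "?E (\<lambda>a b c. f c b) = 0"
    by (subst swap, simp add: avg_rules)+
  ultimately have Y: "?E ?Y = 0" and Z: "?E ?Z = 0"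
    by (simp_all add: avg_rules avg2_transposed)
  have cycle: "?E (\<lambda>a b c. f a c * f c b * f b a) = \<kappa>"
    unfolding \<kappa>_def by (subst swap) simp
  have linear: "?E (\<lambda>a b c. X1 a b c - X2 a b c - X3 a b c - X4 a b c + X5 a b c + X6 a b c + X7 a b c + X8 a b c)
      = ?E X1 - ?E X2 - ?E X3 - ?E X4 + ?E X5 + ?E X6 + ?E X7 + ?E X8" for X1 X2 X3 X4 X5 X6 X7 X8
    by (simp only: avg_add avg_diff)
  have "?E ?X = ?E (\<lambda>a b c. D a * D b * D c - D a * S b c - S a b * D c - D b * S a c
      + f a b * f b c * f c a + f a c * f c b * f b a + ?Y a b c + ?Z a b c)"
    by (intro arg_cong[where f = "avg V"] ext) (simp add: D_def S_def algebra_simps)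
  also have "\<dots> = ?E (\<lambda>a b c. D a * D b * D c) - ?E (\<lambda>a b c. D a * S b c) - ?E (\<lambda>a b c. S a b * D c)
      - ?E (\<lambda>a b c. D b * S a c) + \<kappa> + ?E (\<lambda>a b c. f a c * f c b * f b a) + ?E ?Y + ?E ?Z"
    unfolding \<kappa>_def by (rule linear)
  also have "\<dots> = (1 + m) ^ 3 + 3 * ((1 + m) * (1 - \<rho>)) + 2 * \<kappa>"
    unfolding Y Z cycle
    by (simp only: avg_cmult avg_multc avg_const D S) (simp add: power3_eq_cube algebra_simps)
  finally have E: "?E ?X = (1 + m) ^ 3 + 3 * ((1 + m) * (1 - \<rho>)) + 2 * \<kappa>" .
  have "0 \<le> (1 + m) * (1 - \<rho>)" using m avg2_prod_le by (simp add: \<rho>_def)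
  moreover have "- r \<le> \<kappa>" unfolding \<kappa>_def by (rule avg3_cycle_ge)
  ultimately have "(1 + m) ^ 3 - 2 * r \<le> ?E ?X" unfolding E by linarith
  moreover obtain a where "?E ?X \<le> avg V (\<lambda>b. avg V (?X a b))" using ex_ge_avg by blast
  moreover obtain b where "avg V (\<lambda>b. avg V (?X a b)) \<le> avg V (?X a b)" using ex_ge_avg by blast
  moreover obtain c where "avg V (?X a b) \<le> ?X a b c" using ex_ge_avg by blast
  ultimately show ?thesis by (meson order_trans)
qed

end

text \<open>The unit diagonal produces the factors \<open>1 + m\<close>; opposite signs across the
  diagonal give the skew symmetry used in the averages.\<close>

definition triangular_sign :: "nat \<Rightarrow> nat \<Rightarrow> real" where
  "triangular_sign i j = (if i \<le> j then 1 else -1)"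

context
  fixes h A
  assumes A: "hadamard_matrix h A" and h: "h \<ge> 1"
begin

interpretation kernel_average "Pow {..<h}" "kernel A h" "mean_abs_sum h" "sqrt (real h)"
proof
  show "avg (Pow {..<h}) (\<lambda>a. kernel A h a a) = mean_abs_sum h"
    using sum_kernel_diag[OF A h] by (simp add: avg_def card_Pow)
  show "avg (Pow {..<h}) (kernel A h a) = 0" for a
    using sum_kernel_right[OF A h] by (simp add: avg_def)
  show "avg (Pow {..<h}) (\<lambda>b. (kernel A h a b)\<^sup>2) = 1" for a
    using sum_kernel_right_sq[OF A h] by (simp add: avg_def card_Pow)
  show "\<bar>kernel A h a b\<bar> \<le> sqrt (real h)" for a b
    by (rule abs_kernel_le[OF A h])
qed auto

lemma max_det_ge:
  "d \<ge> 1 \<Longrightarrow> d \<le> 3 \<Longrightarrow> max_det (h + d)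
    \<ge> real h powr (real h / 2) * ((1 + mean_abs_sum h) ^ d - (if d = 3 then 2 * sqrt (real h) else 0))"
  (is "_ \<Longrightarrow> _ \<Longrightarrow> _ \<ge> _ * ?Q")
proof -
  assume d: "d \<ge> 1" "d \<le> 3"
  let ?X = "\<lambda>T. mat d d (\<lambda>(i, j). triangular_sign i j + kernel A h (T i) (T j))"
  have "\<exists>T. ?Q \<le> det (?X T)"
  proof -
    consider "d = 1" | "d = 2" | "d = 3" using d by linarith
    then show ?thesis
    proof cases
      case 1
      obtain a where "1 + mean_abs_sum h \<le> 1 + kernel A h a a" using exists_shift_ge_1 by blast
      with 1 show ?thesis by (intro exI[of _ "\<lambda>_. a"]) (simp only: 1 det_mat_1, simp add: triangular_sign_def)
    next
      case 2
      obtain a b where "(1 + mean_abs_sum h)\<^sup>2 \<le> (1 + kernel A h a a) * (1 + kernel A h b b)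
          - (1 + kernel A h a b) * (- 1 + kernel A h b a)" using exists_shift_ge_2 by blast
      then show ?thesis
        by (intro exI[of _ "\<lambda>i. if i = 0 then a else b"])
          (simp only: 2 det_mat_2, simp add: triangular_sign_def)
    next
      case 3
      have "mean_abs_sum h \<ge> 0" by (simp add: mean_abs_sum_def sum_nonneg)
      from exists_shift_ge_3[OF this] obtain a b c where
        "(1 + mean_abs_sum h) ^ 3 - 2 * sqrt (real h)
          \<le> (1 + kernel A h a a) * ((1 + kernel A h b b) * (1 + kernel A h c c) - (1 + kernel A h b c) * (- 1 + kernel A h c b))
          - (- 1 + kernel A h b a) * ((1 + kernel A h a b) * (1 + kernel A h c c) - (1 + kernel A h a c) * (- 1 + kernel A h c b))
          + (- 1 + kernel A h c a) * ((1 + kernel A h a b) * (1 + kernel A h b c) - (1 + kernel A h a c) * (1 + kernel A h b b))"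
        by blast
      then show ?thesis
        by (intro exI[of _ "\<lambda>i. if i = 0 then a else if i = 1 then b else c"])
          (simp only: 3 det_mat_3, simp add: triangular_sign_def)
    qed
  qed
  then obtain T where "?Q \<le> det (?X T)" by blast
  then have "real h powr (real h / 2) * ?Q \<le> real h powr (real h / 2) * det (?X T)"
    by (intro mult_left_mono) auto
  also have "\<dots> \<le> max_det (h + d)"
    by (rule max_det_bordered_hadamard[OF A h]) (simp add: triangular_sign_def)
  finally show ?thesis .
qed

end

subsection \<open>Numerical estimates\<close>

lemma central_binomial_step:
  "real (2 * Suc k choose Suc k) * (real k + 1) = 2 * (2 * real k + 1) * real (2 * k choose k)"
proof -
  have *: "real (2 * m choose m) = fact (2 * m) / (fact m * fact m)" for m
    using binomial_fact[of m "2 * m", where ?'a = real] by simp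
  have f: "fact (2 * Suc k) = 2 * (real k + 1) * (2 * real k + 1) * (fact (2 * k) :: real)"
    by (simp add: algebra_simps)
  have g: "fact (Suc k) = (real k + 1) * (fact k :: real)" by simp
  have "fact k * fact k \<noteq> (0::real)" "real k + 1 \<noteq> 0" by auto
  then show ?thesis unfolding * f g by (simp add: divide_simps) (simp add: algebra_simps)
qed

lemma wallis_prod_central_binomial:
  "(\<Prod>k=1..n. (4 * real k ^ 2) / (4 * real k ^ 2 - 1)) * ((2 * real n + 1) * real (2 * n choose n) ^ 2) = 16 ^ n"
proof (induction n)
  case (Suc n)
  let ?P = "\<Prod>k=1..n. (4 * real k ^ 2) / (4 * real k ^ 2 - 1)"
  let ?b = "real (2 * n choose n)" and ?b' = "real (2 * Suc n choose Suc n)" and ?x = "real n + 1"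
  have b': "?b' = 2 * (2 * real n + 1) * ?b / ?x"
    using central_binomial_step[of n] by (simp add: field_simps)
  have nz: "4 * ?x\<^sup>2 - 1 = (2 * real n + 1) * (2 * real n + 3)"
    by (simp add: power2_eq_square algebra_simps)
  have "(\<Prod>k=1..Suc n. (4 * real k ^ 2) / (4 * real k ^ 2 - 1)) * ((2 * real (Suc n) + 1) * ?b' ^ 2)
     = ?P * (4 * ?x\<^sup>2 / (4 * ?x\<^sup>2 - 1)) * ((2 * real n + 3) * ?b' ^ 2)"
    by (simp add: add_ac)
  also have "\<dots> = ?P * (16 * (2 * real n + 1) * ?b\<^sup>2)"
    unfolding b' nz by (simp add: divide_simps) (simp add: power2_eq_square algebra_simps)
  also have "\<dots> = 16 * (?P * ((2 * real n + 1) * ?b\<^sup>2))" by (simp only: mult_ac)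
  also have "\<dots> = 16 ^ Suc n" unfolding Suc.IH by simp
  finally show ?case .
qed simp

text \<open>All factors are at least 1, so the partial products increase to their limit.\<close>

lemma wallis_prod_le: "(\<Prod>k=1..n. (4 * real k ^ 2) / (4 * real k ^ 2 - 1)) \<le> pi / 2"
proof (rule incseq_le[OF _ wallis], rule incseq_SucI)
  fix n
  let ?P = "\<lambda>n. \<Prod>k=1..n. (4 * real k ^ 2) / (4 * real k ^ 2 - 1)"
  have *: "1 \<le> (4 * real k ^ 2) / (4 * real k ^ 2 - 1)" if "k \<ge> 1" for k
  proof -
    have "1 \<le> real k ^ 2" using that by simp
    then show ?thesis by (simp add: divide_simps)
  qed
  have "?P n \<ge> 0" by (intro prod_nonneg) (use * order_trans[OF zero_le_one] in auto)
  then have "?P n * 1 \<le> ?P n * ((4 * real (Suc n) ^ 2) / (4 * real (Suc n) ^ 2 - 1))"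
    using *[of "Suc n"] by (intro mult_left_mono) simp_all
  then show "?P n \<le> ?P (Suc n)" by simp
qed

lemma central_binomial_lower_bound:
  "2 / (pi * (2 * real n + 1)) \<le> (real (2 * n choose n) / 4 ^ n)\<^sup>2"
proof -
  let ?P = "\<Prod>k=1..n. (4 * real k ^ 2) / (4 * real k ^ 2 - 1)"
  let ?y = "(2 * real n + 1) * real (2 * n choose n) ^ 2"
  have "16 ^ n = ?P * ?y" by (rule wallis_prod_central_binomial[symmetric])
  also have "\<dots> \<le> pi / 2 * ?y" by (intro mult_right_mono wallis_prod_le) simp
  finally have "16 ^ n * 2 \<le> pi * ?y" by simp
  moreover have "(4 ^ n)\<^sup>2 = (16 :: real) ^ n" by (simp add: power2_eq_square flip: power_mult_distrib)
  ultimately show ?thesis by (simp add: power_divide divide_simps) (simp add: mult_ac)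
qed

lemma sqrt_2_div_pi_bounds:
  defines "c \<equiv> sqrt (2 / pi)"
  shows "0.79 < c" "c < 0.8" "c\<^sup>2 = 2 / pi" "0.636 < c\<^sup>2" "c\<^sup>2 < 0.637"
proof -
  show c2: "c\<^sup>2 = 2 / pi" by (simp add: c_def)
  show "0.636 < c\<^sup>2" "c\<^sup>2 < 0.637" unfolding c2 using pi_approx by (simp_all add: divide_simps)
  then have "0.79\<^sup>2 < c\<^sup>2" "c\<^sup>2 < 0.8\<^sup>2" by (simp_all add: power2_eq_square)
  moreover have "c \<ge> 0" by (simp add: c_def)
  ultimately show "0.79 < c" "c < 0.8" using power_less_imp_less_base[of _ 2] by fastforce+
qed

section \<open>Comparison of the averaged determinant with \<open>(2 * n / pi)^(d/2)\<close>\<close>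

context
  fixes h :: nat and c s M :: real
  assumes h: "h \<ge> 1"
  defines "c \<equiv> sqrt (2 / pi)" and "s \<equiv> sqrt (real h + 1)"
  assumes M: "M \<ge> 1 + c * (s - 1 / s)"
begin

lemma s_props: "s\<^sup>2 = real h + 1" "s > 1"
  using h by (simp_all add: s_def)

lemma powr_half_eq:
  assumes "x > 0" shows "(2 / pi * x) powr (real d / 2) = (c * sqrt x) ^ d"
proof -
  have "(2 / pi * x) powr (real d / 2) = ((2 / pi * x) powr (1/2)) powr real d"
    by (simp add: powr_powr)
  also have "(2 / pi * x) powr (1/2) = c * sqrt x"
    using assms by (simp add: powr_half_sqrt c_def flip: real_sqrt_mult)
  also have "(c * sqrt x) powr real d = (c * sqrt x) ^ d"
    using assms by (intro powr_realpow) (simp add: c_def)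
  finally show ?thesis .
qed

lemma shifted_power_ge_1: "M \<ge> c * s"
proof -
  have "c \<le> s" using sqrt_2_div_pi_bounds(2) s_props by (simp add: c_def)
  then have "c / s \<le> 1" using s_props by (simp add: divide_simps)
  then show ?thesis using M by (simp add: algebra_simps)
qed

text \<open>With \<open>t = 1 / s\<close>, expanding the square cancels \<open>c^2 * s^2\<close> and
  leaves \<open>1 + 2 * c * (s - t) + c^2 * t^2 \<ge> 3 * c^2\<close>, which follows from
  \<open>c * (s - t) \<ge> 0.553\<close> and \<open>c^2 < 0.637\<close>.\<close>

lemma shifted_power_ge_2: "M\<^sup>2 \<ge> c\<^sup>2 * (s\<^sup>2 + 1)"
proof -
  define t where "t = 1 / s"
  have st: "s * t = 1" using s_props by (simp add: t_def)
  have "s \<ge> 1.41" unfolding s_def by (rule real_le_rsqrt) (use h in \<open>simp add: power2_eq_square\<close>)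
  then have t: "0 \<le> t" "t \<le> 0.71" by (simp_all add: t_def divide_simps)
  have x: "s - t \<ge> 0.7" using \<open>s \<ge> 1.41\<close> t by simp
  have "(s - t)\<^sup>2 = s\<^sup>2 - 2 * (s * t) + t\<^sup>2" by (simp add: power2_eq_square algebra_simps)
  then have sq: "(s - t)\<^sup>2 = s\<^sup>2 - 2 + t\<^sup>2" using st by simp
  have "79/100 * (7/10) \<le> c * (s - t)"
    using sqrt_2_div_pi_bounds(1) x by (intro mult_mono) (auto simp: c_def)
  moreover have "c\<^sup>2 < 637/1000" using sqrt_2_div_pi_bounds(5) by (simp add: c_def)
  moreover have "0 \<le> c\<^sup>2 * t\<^sup>2" by simp
  moreover have "(1 + c * (s - t))\<^sup>2 = 1 + 2 * (c * (s - t)) + c\<^sup>2 * (s - t)\<^sup>2"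
    by (simp add: power2_eq_square algebra_simps)
  then have "(1 + c * (s - t))\<^sup>2 = 1 + 2 * (c * (s - t)) + c\<^sup>2 * s\<^sup>2 - 2 * c\<^sup>2 + c\<^sup>2 * t\<^sup>2"
    unfolding sq by (simp add: algebra_simps)
  moreover have "c\<^sup>2 * (s\<^sup>2 + 1) = c\<^sup>2 * s\<^sup>2 + c\<^sup>2" by (simp add: algebra_simps)
  ultimately have "c\<^sup>2 * (s\<^sup>2 + 1) \<le> (1 + c * (s - t))\<^sup>2" by linarith
  also have "\<dots> \<le> M\<^sup>2"
    using M x sqrt_2_div_pi_bounds(1) by (intro power_mono) (auto simp: t_def c_def)
  finally show ?thesis .
qed

text \<open>With \<open>t = 1 / s\<close>, the square of \<open>s + t\<close> exceeds
  \<open>s^2 + 2\<close>, so the root on the right may be replaced by \<open>s + t\<close>; likewise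
  \<open>sqrt h\<close> is at most \<open>s\<close>. What remains is polynomial in \<open>s\<close>,
  \<open>t\<close> and \<open>c\<close>, and \<open>h \<ge> 4\<close> supplies
  \<open>s \<ge> 2.236\<close>.\<close>

lemma shifted_power_ge_3:
  assumes "h \<ge> 4" shows "M ^ 3 - 2 * sqrt (real h) \<ge> (c * sqrt (s\<^sup>2 + 2)) ^ 3"
proof -
  define t where "t = 1 / s"
  have st: "s * t = 1" using s_props by (simp add: t_def)
  have s: "s \<ge> 2.236" unfolding s_def
    by (rule real_le_rsqrt) (use assms in \<open>simp add: power2_eq_square\<close>)
  then have "t \<le> 1" "0 \<le> t" by (simp_all add: t_def divide_simps)
  with s have t0: "0 \<le> t" "t \<le> s" by simp_all
  have c: "0.79 < c" "0.636 < c\<^sup>2" "c\<^sup>2 < 0.637" "c < 0.8"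
    using sqrt_2_div_pi_bounds by (simp_all add: c_def)
  have c3: "0.5 \<le> c ^ 3" "c ^ 3 \<le> 0.5096"
  proof -
    have "0.79 * 0.636 \<le> c * c\<^sup>2" "c * c\<^sup>2 \<le> 0.8 * 0.637"
      by (rule mult_mono; use c in simp)+
    then show "0.5 \<le> c ^ 3" "c ^ 3 \<le> 0.5096" by (simp_all add: power2_eq_square power3_eq_cube)
  qed
  have t2: "t\<^sup>2 \<le> 0.2" using assms s_props by (simp add: t_def power_divide divide_simps)
  have "(s - t)\<^sup>2 = s\<^sup>2 - 2 * (s * t) + t\<^sup>2" by (simp add: power2_eq_square algebra_simps)
  then have sq: "(s - t)\<^sup>2 = s\<^sup>2 - 2 + t\<^sup>2" using st by simp
  have "(s - t) ^ 3 = s ^ 3 - 3 * s * (s * t) + 3 * t * (s * t) - t ^ 3"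
    by (simp add: power3_eq_cube algebra_simps)
  then have cu: "(s - t) ^ 3 = s ^ 3 - 3 * s + 3 * t - t ^ 3" using st by simp
  have exp: "(1 + c * (s - t)) ^ 3 = 1 + 3 * c * (s - t) + 3 * c\<^sup>2 * (s - t)\<^sup>2 + c ^ 3 * (s - t) ^ 3"
    by (simp add: power3_eq_cube power2_eq_square algebra_simps)
  have "(s\<^sup>2 + 2) * (s + t) = s ^ 3 + s * (s * t) + 2 * s + 2 * t"
    by (simp add: power3_eq_cube power2_eq_square algebra_simps)
  then have rhs: "(s\<^sup>2 + 2) * (s + t) = s ^ 3 + 3 * s + 2 * t" using st by simp
  have "0 \<le> 1 + 3 * (c * (s - t)) + 3 * (c\<^sup>2 * (s\<^sup>2 - 2 + t\<^sup>2)) - 6 * (c ^ 3 * s)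
      + c ^ 3 * (t * (1 - t\<^sup>2)) - 2 * s"
    (is "0 \<le> 1 + 3 * ?x1 + 3 * ?x2 - 6 * ?x3 + ?x4 - 2 * s")
  proof -
    have "79/100 * (s - t) \<le> ?x1" using c t0 by (intro mult_right_mono) auto
    moreover have "636/1000 * (s\<^sup>2 - 2 + t\<^sup>2) \<le> ?x2"
      using c sq[symmetric] by (intro mult_right_mono) auto
    moreover have "?x3 \<le> 5096/10000 * s" using c3 s by (intro mult_right_mono) auto
    moreover have "1/2 * (t * (4/5)) \<le> ?x4"
      using c c3 t0 t2 by (intro mult_mono mult_left_mono) auto
    \<comment> \<open>A tangent line to the square. Its slope is chosen so that
      \<open>3 * 0.636 * 26/25\<close> exceeds \<open>3 * 0.79 - 0.4\<close>, which removes
      \<open>t\<close> from the estimate.\<close>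
    moreover have "0 \<le> (t - 13/25)\<^sup>2" by simp
    then have "26/25 * t \<le> t\<^sup>2 + 169/625" by (simp add: power2_eq_square algebra_simps)
    moreover have "2236/1000 * s \<le> s\<^sup>2" using s by (simp add: power2_eq_square)
    moreover have "2236/1000 \<le> s" "0 \<le> t" using s t0 by simp_all
    \<comment> \<open>Products and squares become independent variables, so that the final
      inequality is linear.\<close>
    moreover have "0 \<le> 1 + 3 * x1 + 3 * x2 - 6 * x3 + x4 - 2 * s"
      if "79/100 * (s - t) \<le> x1" "636/1000 * (s2 - 2 + t2) \<le> x2" "x3 \<le> 5096/10000 * s"
        "1/2 * (t * (4/5)) \<le> x4" "26/25 * t \<le> t2 + 169/625" "2236/1000 * s \<le> s2"
        "2236/1000 \<le> s" "0 \<le> t"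
      for x1 x2 x3 x4 s2 t2 :: real
      using that by simp
    ultimately show ?thesis by blast
  qed
  then have "c ^ 3 * ((s\<^sup>2 + 2) * (s + t)) \<le> (1 + c * (s - t)) ^ 3 - 2 * s"
    unfolding exp sq cu rhs by (simp add: power3_eq_cube power2_eq_square algebra_simps)
  also have "\<dots> \<le> M ^ 3 - 2 * sqrt (real h)"
  proof -
    have "(1 + c * (s - t)) ^ 3 \<le> M ^ 3"
      using M t0 c by (intro power_mono) (auto simp: t_def)
    moreover have "sqrt (real h) \<le> s" by (simp add: s_def)
    ultimately show ?thesis by simp
  qed
  finally have "c ^ 3 * ((s\<^sup>2 + 2) * (s + t)) \<le> M ^ 3 - 2 * sqrt (real h)" .
  moreover have "sqrt (s\<^sup>2 + 2) \<le> s + t"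
    using s t0 st by (intro real_le_lsqrt) (auto simp: power2_sum mult.assoc)
  then have "c ^ 3 * ((s\<^sup>2 + 2) * sqrt (s\<^sup>2 + 2)) \<le> c ^ 3 * ((s\<^sup>2 + 2) * (s + t))"
    using c by (intro mult_left_mono) auto
  moreover have "(c * sqrt (s\<^sup>2 + 2)) ^ 3 = c ^ 3 * ((s\<^sup>2 + 2) * sqrt (s\<^sup>2 + 2))"
    by (simp add: power_mult_distrib power3_eq_cube)
  ultimately show ?thesis by linarith
qed

end

section \<open>From determinant bounds to the normalised ratio\<close>

lemma ratio_powr_gt:
  fixes x \<delta> :: real
  assumes x: "x > 0" and \<delta>: "\<delta> > 0"
  shows "exp (- (\<delta> / 2)) < x powr (x / 2) / (x + \<delta>) powr (x / 2)"
proof -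
  \<comment> \<open>This is the source of strictness in the bound for the ratio.\<close>
  have "ln (1 + \<delta> / x) < \<delta> / x"
    using x \<delta> ln_add_one_self_less_self[of "\<delta> / x"] by simp
  moreover have "1 + \<delta> / x = (x + \<delta>) / x"
    using x by (simp add: add_divide_distrib)
  moreover have "ln ((x + \<delta>) / x) = ln (x + \<delta>) - ln x"
    using x \<delta> by (simp add: ln_div)
  ultimately have "x / 2 * (ln (x + \<delta>) - ln x) < x / 2 * (\<delta> / x)"
    using x by (intro mult_strict_left_mono) auto
  then have "- (\<delta> / 2) < x / 2 * ln x - x / 2 * ln (x + \<delta>)"
    using x by (simp add: algebra_simps)
  then have "exp (- (\<delta> / 2)) < exp (x / 2 * ln x - x / 2 * ln (x + \<delta>))" by simp
  also have "\<dots> = x powr (x / 2) / (x + \<delta>) powr (x / 2)"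
    using x \<delta> by (simp add: powr_def exp_diff)
  finally show ?thesis .
qed

text \<open>Split \<open>n^(n/2)\<close> as \<open>n^(h/2) * n^(d/2)\<close>: the first factor
  against \<open>h^(h/2)\<close> costs less than \<open>e^(d/2)\<close>, the second is absorbed by
  \<open>Q\<close>.\<close>

lemma max_det_ratio_gt:
  assumes h: "h \<ge> 1" and d: "d \<ge> 1"
    and D: "max_det (h + d) \<ge> real h powr (real h / 2) * Q"
    and Q: "Q \<ge> (2 / pi * real (h + d)) powr (real d / 2)"
  shows "max_det_ratio (h + d) > (2 / (pi * exp 1)) powr (real d / 2)"
proof -
  let ?n = "real h + real d" and ?c = "(2 / pi) powr (real d / 2)"
  let ?hh = "real h powr (real h / 2)" and ?nh = "?n powr (real h / 2)" and ?nd = "?n powr (real d / 2)"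
  have pos: "?nh > 0" "?nd > 0" "?c > 0" using h by simp_all
  have "2 / (pi * exp 1) = 2 / pi * exp (-1 :: real)"
    by (simp add: exp_minus divide_inverse)
  then have "(2 / (pi * exp 1)) powr (real d / 2) = ?c * exp (-1) powr (real d / 2)"
    by (simp only: powr_mult)
  also have "exp (-1 :: real) powr (real d / 2) = exp (- (real d / 2))"
    by (simp add: powr_def)
  also have "?c * exp (- (real d / 2)) < ?c * (?hh / ?nh)"
    using ratio_powr_gt[of "real h" "real d"] h d pos by (intro mult_strict_left_mono) simp_all
  also have "\<dots> = ?hh * (?c * ?nd) / (?nh * ?nd)"
    using pos by (simp only: divide_simps mult_ac) simp
  also have "?c * ?nd = (2 / pi * ?n) powr (real d / 2)"
    by (simp only: powr_mult)
  also have "?nh * ?nd = ?n powr (?n / 2)"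
    by (simp only: powr_add[symmetric] add_divide_distrib)
  also have "?hh * (2 / pi * ?n) powr (real d / 2) / ?n powr (?n / 2) \<le> ?hh * Q / ?n powr (?n / 2)"
    using Q by (intro divide_right_mono mult_left_mono) simp_all
  also have "\<dots> \<le> max_det (h + d) / ?n powr (?n / 2)"
    using D by (intro divide_right_mono) simp_all
  also have "\<dots> = max_det_ratio (h + d)"
    by (simp add: max_det_ratio_def)
  finally show ?thesis .
qed

text \<open>As \<open>s - 1/s = h/s\<close> for \<open>s = sqrt (h + 1)\<close>, the Wallis bound at
  \<open>h / 2\<close> gives the even case; for \<open>h = 1\<close> the mean is exactly 1.\<close>

lemma mean_abs_sum_lower_bound:
  assumes "h = 1 \<or> even h"
  shows "sqrt (2 / pi) * (sqrt (real h + 1) - 1 / sqrt (real h + 1)) \<le> mean_abs_sum h"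
proof -
  let ?s = "sqrt (real h + 1)"
  have s: "?s > 0" "?s * ?s = real h + 1" by simp_all
  then have "?s - 1 / ?s = real h / ?s" by (simp add: divide_simps)
  moreover have "sqrt (2 / pi) * (real h / ?s) \<le> mean_abs_sum h"
  proof (cases "h = 1")
    case True
    have "sqrt (2 / pi) \<le> 1" using sqrt_2_div_pi_bounds(2) by linarith
    then have "sqrt (2 / pi) * (1 / sqrt 2) \<le> 1 * 1" by (rule mult_mono) auto
    with True show ?thesis using mean_abs_sum_1 by (simp del: real_sqrt_divide real_sqrt_le_1_iff)
  next
    case False
    then obtain k where k: "h = 2 * k" using assms by (auto elim: evenE)
    have "sqrt (2 / pi) / ?s = sqrt (2 / (pi * (2 * real k + 1)))"
      by (simp add: k real_sqrt_divide real_sqrt_mult)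
    also have "\<dots> \<le> real (2 * k choose k) / 4 ^ k"
      by (rule real_le_lsqrt) (use central_binomial_lower_bound[of k] in auto)
    finally have "real h * (sqrt (2 / pi) / ?s) \<le> real h * (real (2 * k choose k) / 4 ^ k)"
      by (rule mult_left_mono) simp
    moreover have "mean_abs_sum h = real h * (real (2 * k choose k) / 4 ^ k)"
      using mean_abs_sum_even[of h] k by (simp add: power_mult)
    ultimately show ?thesis by (simp add: mult_ac)
  qed
  ultimately show ?thesis by simp
qed

lemma half_binomial_le_mean_abs_sum:
  assumes "h = 1 \<or> even h"
  shows "real h / 2 ^ h * half_binomial h \<le> mean_abs_sum h"
proof (cases "h = 1")
  case True
  have "4 / pi \<le> 2" using pi_gt3 by (simp add: divide_simps)
  with True show ?thesis using half_binomial_1 mean_abs_sum_1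
    by (simp add: divide_le_eq)
next
  case False
  then show ?thesis using assms by (simp add: mean_abs_sum_even half_binomial_def)
qed

text \<open>The case missed by \<open>shifted_power_ge_3\<close>.\<close>

lemma max_det_ratio_5_gt:
  assumes "max_det 5 \<ge> 2 * (8 - 2 * sqrt 2)"
  shows "max_det_ratio 5 > (2 / (pi * exp 1)) powr (3 / 2)"
proof -
  have "sqrt 2 \<le> 3 / 2" "sqrt 5 \<le> 9 / 4" by (rule real_le_lsqrt; simp add: power2_eq_square)+
  then have m: "max_det 5 \<ge> 10" using assms by simp
  have "pi * exp 1 \<ge> 3 * (5 / 2)"
    using pi_gt3 exp_lower_Taylor_quadratic[of 1] by (intro mult_mono) auto
  \<comment> \<open>The bound is a square so that the power \<open>3/2\<close> turns into a cube;
    \<open>2 / 7.5\<close> lies just below it.\<close>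
  then have "2 / (pi * exp 1) \<le> (13 / 25)\<^sup>2" by (simp add: divide_simps)
  then have "(2 / (pi * exp 1)) powr (3 / 2) \<le> ((13 / 25)\<^sup>2) powr (3 / 2)"
    by (intro powr_mono2) auto
  also have "\<dots> = (13 / 25) ^ 3"
    using powr_powr[of "13 / 25" 2 "3 / 2"] by (simp del: power_divide)
  also have "\<dots> < 10 / (25 * (9 / 4))" by (simp add: power3_eq_cube)
  also have "\<dots> \<le> 10 / (25 * sqrt 5)"
    using \<open>sqrt 5 \<le> 9 / 4\<close> by (intro divide_left_mono) auto
  also have "\<dots> \<le> max_det 5 / (25 * sqrt 5)"
    using m by (intro divide_right_mono) auto
  also have "25 * sqrt 5 = 5 powr (5 / 2)"
    using powr_add[of "5 :: real" 2 "1 / 2"] by (simp add: powr_half_sqrt)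
  finally show ?thesis by (simp add: max_det_ratio_def)
qed

theorem theorem3p6:
  fixes d h n :: nat and \<mu> \<eta> :: real
  assumes "1 \<le> d" and "d \<le> 3"
    and "h \<ge> 1" and "\<exists>A. hadamard_matrix h A"
    and "n = h + d"
    and "\<mu> = 1 + real h / 2 ^ h * half_binomial h"
    and "\<eta> = (if d \<le> 2 then real d - 1 else 5 * real h powr (1 / 2) + 3)"
  shows "max_det n \<ge> real h powr (real h / 2) * (\<mu> ^ d - \<eta>)
    \<and> max_det_ratio n > (2 / (pi * exp 1)) powr (real d / 2)"
proof -
  obtain A where A: "hadamard_matrix h A" using assms(4) by blast
  have order: "h = 1 \<or> even h" by (rule hadamard_order[OF A assms(3)])
  define M where "M = 1 + mean_abs_sum h"
  define q where "q = (if d = 3 then 2 * sqrt (real h) else 0)"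
  have D: "real h powr (real h / 2) * (M ^ d - q) \<le> max_det (h + d)"
    using max_det_ge[OF A assms(3,1,2)] by (simp add: M_def q_def)
  have "0 \<le> \<mu>" "\<mu> \<le> M"
    using half_binomial_le_mean_abs_sum[OF order] assms(3)
    by (simp_all add: assms(6) M_def half_binomial_eq_Gamma Gamma_real_pos)
  then have "\<mu> ^ d \<le> M ^ d" by (intro power_mono)
  \<comment> \<open>Averaging loses nothing for \<open>d \<le> 2\<close> and only
    \<open>2 * sqrt h\<close> for \<open>d = 3\<close>, within the allowed
    \<open>5 * sqrt h + 3\<close>.\<close>
  moreover have "q \<le> \<eta>"
    using assms(1,2) real_sqrt_ge_zero[of "real h"] by (auto simp: q_def assms(7) powr_half_sqrt)
  ultimately have "real h powr (real h / 2) * (\<mu> ^ d - \<eta>) \<le> real h powr (real h / 2) * (M ^ d - q)"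
    by (intro mult_left_mono) auto
  with D have first: "real h powr (real h / 2) * (\<mu> ^ d - \<eta>) \<le> max_det (h + d)" by linarith
  have M: "M \<ge> 1 + sqrt (2 / pi) * (sqrt (real h + 1) - 1 / sqrt (real h + 1))"
    using mean_abs_sum_lower_bound[OF order] by (simp add: M_def)
  have second: "max_det_ratio (h + d) > (2 / (pi * exp 1)) powr (real d / 2)"
  proof (cases "h = 2 \<and> d = 3")
    case True
    have "mean_abs_sum 2 = 1" by (simp add: mean_abs_sum_even)
    with True D have "max_det 5 \<ge> 2 * (8 - 2 * sqrt 2)" by (simp add: M_def q_def)
    with True max_det_ratio_5_gt show ?thesis by simp
  next
    case False
    have "(2 / pi * real (h + d)) powr (real d / 2) = (sqrt (2 / pi) * sqrt (real (h + d))) ^ d"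
      using assms(3) by (intro powr_half_eq) auto
    also have "\<dots> \<le> M ^ d - q"
    proof -
      consider "d = 1" | "d = 2" | "d = 3" "h = 1" | "d = 3" "h \<ge> 4"
      proof -
        have "d = 1 \<or> d = 2 \<or> d = 3" using assms(1,2) by linarith
        moreover have "h = 1 \<or> h \<ge> 4" if "d = 3"
        proof -
          have "h \<noteq> 2" "h \<noteq> 3" using False that order by auto
          then show ?thesis using assms(3) by linarith
        qed
        ultimately show ?thesis using that by blast
      qed
      then show ?thesis
      proof cases
        case 1
        then show ?thesis using shifted_power_ge_1[OF assms(3) M] by (simp add: q_def add_ac)
      next
        case 2
        then show ?thesis using shifted_power_ge_2[OF assms(3) M]
          by (simp add: q_def power_mult_distrib add_ac)
      next
        case 3
        \<comment> \<open>Here \<open>M = 2\<close> and \<open>n = 4\<close>, so the target is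
          \<open>(2 * c)^3 \<le> 8 - 2\<close> with \<open>c = sqrt (2 / pi)\<close>.\<close>
        have "(4 / 5 * 2) ^ 3 \<ge> (sqrt (2 / pi) * 2) ^ 3"
          using sqrt_2_div_pi_bounds(2) by (intro power_mono mult_right_mono) auto
        moreover have "(4 / 5 * 2) ^ 3 \<le> (6::real)" by (simp add: power3_eq_cube)
        ultimately have "(sqrt (2 / pi) * 2) ^ 3 \<le> 6" by linarith
        with 3 show ?thesis using mean_abs_sum_1 by (simp add: M_def q_def)
      next
        case 4
        then show ?thesis using shifted_power_ge_3[OF assms(3) M] by (simp add: q_def add_ac)
      qed
    qed
    finally show ?thesis by (intro max_det_ratio_gt[OF assms(3,1) D])
  qed
  show ?thesis using first second assms(5) by simp
qed

end
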